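(* Let $G$ be an equitably 3-colorable graph on $n\ge 2$ vertices and let $k\ge 2$, $l\ge 1$ be integers. If $3$ divides $n$ or $k=2$, then $\chi_{=}(G\circ^l C_{2k})=3$.
   Context: All graphs are finite, simple and connected. $C_m$ denotes the cycle on $m$ vertices. A graph is equitably $k$-colorable if its vertex set can be partitioned into $k$ (possibly empty) independent sets $V_1,\dots,V_k$ with $||V_i|-|V_j||\le 1$ for all $i,j$; $\chi_{=}(G)$ is the least $k$ for which $G$ is equitably $k$-colorable. The corona $G\circ H$ is formed from one copy of $G$ and $|V(G)|$ copies of $H$, the $i$-th vertex of $G$ being joined to every vertex of the $i$-th copy of $H$; $G\circ^1 H=G\circ H$ and $G\circ^l H=(G\circ^{l-1}H)\circ H$ for $l\ge 2$. *)

theory Defs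
  imports "Graph_Theory.Graph_Theory" "HOL-Library.Disjoint_Sets"
begin

text \<open>
  Finite simple graphs are the graphs of the locale \<^locale>\<open>pair_graph\<close>: finite, loop-free and
  symmetric, an edge between \<open>u\<close> and \<open>v\<close> being represented by the two arcs \<open>(u, v)\<close> and \<open>(v, u)\<close>.
\<close>

definition cycle_graph :: "nat \<Rightarrow> nat pair_pre_digraph" where
  "cycle_graph m = \<lparr> pverts = {..<m},
     parcs = {(i, j). i < m \<and> j < m \<and> (j = Suc i mod m \<or> i = Suc j mod m)} \<rparr>"

definition independent_set :: "'a pair_pre_digraph \<Rightarrow> 'a set \<Rightarrow> bool" where
  "independent_set G S \<longleftrightarrow> S \<subseteq> pverts G \<and> (\<forall>u\<in>S. \<forall>v\<in>S. (u, v) \<notin> parcs G)"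

definition equitably_colorable :: "'a pair_pre_digraph \<Rightarrow> nat \<Rightarrow> bool" where
  "equitably_colorable G k \<longleftrightarrow> (\<exists>V :: nat \<Rightarrow> 'a set.
     (\<Union>i<k. V i) = pverts G \<and> disjoint_family_on V {..<k} \<and>
     (\<forall>i<k. independent_set G (V i)) \<and>
     (\<forall>i<k. \<forall>j<k. \<bar>int (card (V i)) - int (card (V j))\<bar> \<le> 1))"

definition equitable_chromatic_number :: "'a pair_pre_digraph \<Rightarrow> nat" where
  "equitable_chromatic_number G = (LEAST k. equitably_colorable G k)"

text \<open>
  In the corona, \<open>Inl v\<close> is the vertex \<open>v\<close> of the copy of \<open>G\<close>, and \<open>Inr (v, x)\<close> is the vertex \<open>x\<close>
  of the copy of \<open>H\<close> attached to \<open>v\<close>.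
\<close>

definition corona ::
  "'a pair_pre_digraph \<Rightarrow> 'b pair_pre_digraph \<Rightarrow> ('a + 'a \<times> 'b) pair_pre_digraph" where
  "corona G H = \<lparr> pverts = Inl ` pverts G \<union> Inr ` (pverts G \<times> pverts H),
     parcs = {(Inl u, Inl v) | u v. (u, v) \<in> parcs G}
       \<union> {(Inr (v, x), Inr (v, y)) | v x y. v \<in> pverts G \<and> (x, y) \<in> parcs H}
       \<union> {(Inl v, Inr (v, x)) | v x. v \<in> pverts G \<and> x \<in> pverts H}
       \<union> {(Inr (v, x), Inl v) | v x. v \<in> pverts G \<and> x \<in> pverts H} \<rparr>"

text \<open>
  Each corona changes the type of the vertices. To iterate it, the vertices are renamed along the
  injective constructors of a type \<open>'c\<close> that contains both \<open>'a\<close> and \<open>'c + 'c \<times> 'b\<close>.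
\<close>

datatype ('a, 'b) corona_vertex =
    Base 'a
  | Step "('a, 'b) corona_vertex + ('a, 'b) corona_vertex \<times> 'b"

definition rename_verts :: "('a \<Rightarrow> 'b) \<Rightarrow> 'a pair_pre_digraph \<Rightarrow> 'b pair_pre_digraph" where
  "rename_verts f G = \<lparr> pverts = f ` pverts G, parcs = map_prod f f ` parcs G \<rparr>"

primrec iterated_corona ::
  "nat \<Rightarrow> 'a pair_pre_digraph \<Rightarrow> 'b pair_pre_digraph \<Rightarrow> ('a, 'b) corona_vertex pair_pre_digraph"
where
  "iterated_corona 0 G H = rename_verts Base G"
| "iterated_corona (Suc l) G H = rename_verts Step (corona (iterated_corona l G H) H)"

lemma digraph_iso_rename_verts:
  assumes "pair_wf_digraph G" "inj f"
  shows "digraph_iso (with_proj G) (with_proj (rename_verts f G))"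
proof -
  interpret pair_wf_digraph G by fact
  let ?h = "\<lparr> iso_verts = f, iso_arcs = map_prod f f, iso_head = snd, iso_tail = fst \<rparr>"
  have "pre_digraph.digraph_isomorphism (with_proj G) ?h"
    using assms(2) wf_digraph_axioms
    by (auto simp: pre_digraph.digraph_isomorphism_def inj_on_def map_prod_def
        split: prod.splits)
  moreover have "with_proj (rename_verts f G) = app_iso ?h (with_proj G)"
    by (simp add: app_iso_def with_proj_def rename_verts_def)
  ultimately show ?thesis unfolding digraph_iso_def by blast
qed

lemma pair_graph_rename_verts:
  assumes "pair_graph G" "inj f"
  shows "pair_graph (rename_verts f G)"
proof -
  interpret pair_graph G by fact
  have symG: "\<And>u v. (u, v) \<in> parcs G \<Longrightarrow> (v, u) \<in> parcs G"
    using sym_arcs by (auto simp: symmetric_def dest: symD)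
  moreover have "\<And>u v. (u, v) \<in> parcs G \<Longrightarrow> u \<noteq> v"
    using pair_no_loops by fastforce
  ultimately have noloop: "fst e \<noteq> snd e" if "e \<in> parcs (rename_verts f G)" for e
    using that \<open>inj f\<close> by (auto simp: rename_verts_def inj_eq)
  have wf: "parcs (rename_verts f G) \<subseteq> pverts (rename_verts f G) \<times> pverts (rename_verts f G)"
    by (auto simp: rename_verts_def dest: in_arcsD1 in_arcsD2)
  have "sym (parcs (rename_verts f G))"
    by (rule symI) (force simp: rename_verts_def dest: symG)
  moreover have "finite (pverts (rename_verts f G))" "finite (parcs (rename_verts f G))"
    by (simp_all add: rename_verts_def)
  ultimately show ?thesis
    using wf noloop by unfold_locales (auto simp: symmetric_def)
qed

lemma pair_graph_cycle_graph:
  assumes "m \<ge> 3"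
  shows "pair_graph (cycle_graph m)"
proof -
  have "finite {(i, j). i < m \<and> j < m \<and> (j = Suc i mod m \<or> i = Suc j mod m)}"
    by (rule finite_subset[of _ "{..<m} \<times> {..<m}"]) auto
  moreover have "Suc i mod m \<noteq> i" "i \<noteq> Suc i mod m" if "i < m" for i
    using that assms by (cases "Suc i = m"; auto)+
  ultimately show ?thesis
    by unfold_locales (auto simp: cycle_graph_def symmetric_def intro!: symI)
qed

lemma pair_graph_corona:
  assumes "pair_graph G" "pair_graph H"
  shows "pair_graph (corona G H)"
proof -
  interpret G: pair_graph G by fact
  interpret H: pair_graph H by fact
  have symG: "\<And>u v. (u, v) \<in> parcs G \<Longrightarrow> (v, u) \<in> parcs G"
    using G.sym_arcs by (auto simp: symmetric_def dest: symD)
  have symH: "\<And>u v. (u, v) \<in> parcs H \<Longrightarrow> (v, u) \<in> parcs H"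
    using H.sym_arcs by (auto simp: symmetric_def dest: symD)
  have wf: "parcs (corona G H) \<subseteq> pverts (corona G H) \<times> pverts (corona G H)"
    by (auto simp: corona_def dest: G.in_arcsD1 G.in_arcsD2 H.in_arcsD1 H.in_arcsD2)
  have fin: "finite (pverts (corona G H))"
    by (auto simp: corona_def)
  have "finite (parcs (corona G H))"
    using finite_subset[OF wf] fin by blast
  moreover have "sym (parcs (corona G H))"
    by (rule symI) (auto simp: corona_def symG symH)
  moreover have "fst e \<noteq> snd e" if "e \<in> parcs (corona G H)" for e
    using that by (auto simp: corona_def dest: G.pair_no_loops H.pair_no_loops)
  ultimately show ?thesis
    using wf fin by unfold_locales (auto simp: symmetric_def)
qed

lemma pair_graph_iterated_corona:
  assumes "pair_graph G" "pair_graph H"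
  shows "pair_graph (iterated_corona l G H)"
  using assms by (induction l) (auto intro!: pair_graph_rename_verts pair_graph_corona injI)

lemma digraph_iso_iterated_corona_Suc:
  assumes "pair_graph G" "pair_graph H"
  shows "digraph_iso (with_proj (corona (iterated_corona l G H) H))
    (with_proj (iterated_corona (Suc l) G H))"
proof -
  interpret pair_graph "corona (iterated_corona l G H) H"
    by (intro pair_graph_corona pair_graph_iterated_corona assms)
  show ?thesis
    by (auto intro!: digraph_iso_rename_verts injI)
qed

lemma arc_corona_simps [simp]:
  "(Inl u, Inl v) \<in> parcs (corona G H) \<longleftrightarrow> (u, v) \<in> parcs G"
  "(Inl u, Inr (v, y)) \<in> parcs (corona G H) \<longleftrightarrow> u = v \<and> v \<in> pverts G \<and> y \<in> pverts H"
  "(Inr (u, x), Inl v) \<in> parcs (corona G H) \<longleftrightarrow> u = v \<and> v \<in> pverts G \<and> x \<in> pverts H"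
  "(Inr (u, x), Inr (v, y)) \<in> parcs (corona G H) \<longleftrightarrow>
     u = v \<and> v \<in> pverts G \<and> (x, y) \<in> parcs H"
  by (auto simp: corona_def)

lemma corona_rename_verts:
  fixes f :: "'a \<Rightarrow> 'c" and G :: "'a pair_pre_digraph" and H :: "'b pair_pre_digraph"
  shows "corona (rename_verts f G) H = rename_verts (map_sum f (map_prod f id)) (corona G H)"
proof -
  let ?g = "map_sum f (map_prod f id) :: 'a + 'a \<times> 'b \<Rightarrow> 'c + 'c \<times> 'b"
  have "pverts (corona (rename_verts f G) H) = ?g ` pverts (corona G H)"
    by (force simp: corona_def rename_verts_def)
  moreover have "parcs (corona (rename_verts f G) H) = map_prod ?g ?g ` parcs (corona G H)"
    (is "?L = ?R")
  proof (intro equalityI subrelI)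
    fix p q assume pq: "(p, q) \<in> ?L"
    have "\<exists>p' q'. (p', q') \<in> parcs (corona G H) \<and> p = ?g p' \<and> q = ?g q'"
    proof (cases p; cases q)
      fix u v assume [simp]: "p = Inl u" "q = Inl v"
      from pq obtain u' v' where "(u', v') \<in> parcs G" "u = f u'" "v = f v'"
        by (auto simp: rename_verts_def)
      then show ?thesis by (intro exI[of _ "Inl u'"] exI[of _ "Inl v'"]) simp
    next
      fix u b assume [simp]: "p = Inl u" "q = Inr b"
      obtain v y where [simp]: "b = (v, y)" by fastforce
      from pq obtain v' where "v' \<in> pverts G" "v = f v'" "u = v" "y \<in> pverts H"
        by (auto simp: rename_verts_def)
      then show ?thesis by (intro exI[of _ "Inl v'"] exI[of _ "Inr (v', y)"]) simp
    next
      fix a v assume [simp]: "p = Inr a" "q = Inl v"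
      obtain u x where [simp]: "a = (u, x)" by fastforce
      from pq obtain v' where "v' \<in> pverts G" "v = f v'" "u = v" "x \<in> pverts H"
        by (auto simp: rename_verts_def)
      then show ?thesis by (intro exI[of _ "Inr (v', x)"] exI[of _ "Inl v'"]) simp
    next
      fix a b assume [simp]: "p = Inr a" "q = Inr b"
      obtain u x v y where [simp]: "a = (u, x)" "b = (v, y)" by fastforce
      from pq obtain v' where "v' \<in> pverts G" "v = f v'" "u = v" "(x, y) \<in> parcs H"
        by (auto simp: rename_verts_def)
      then show ?thesis by (intro exI[of _ "Inr (v', x)"] exI[of _ "Inr (v', y)"]) simp
    qed
    then show "(p, q) \<in> ?R" by (metis map_prod_imageI)
  next
    fix p q assume "(p, q) \<in> ?R"
    then obtain p' q' where pq: "(p', q') \<in> parcs (corona G H)" "p = ?g p'" "q = ?g q'"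
      by auto
    then show "(p, q) \<in> ?L"
      by (cases p'; cases q')
        (auto simp: rename_verts_def intro!: image_eqI[where f = "map_prod f f"])
  qed
  ultimately show ?thesis
    by (simp add: rename_verts_def)
qed

lemma iterated_corona_1:
  "iterated_corona 1 G H =
     rename_verts (Step \<circ> map_sum Base (map_prod Base id)) (corona G H)"
  by (simp add: corona_rename_verts)
    (simp add: rename_verts_def image_comp map_prod_compose)

end

theory Submission
  imports Defs
begin

text \<open>
  Given an equitable 3-coloring of \<open>G\<close>, color the even cycle attached to a vertex alternately with
  the two colors which that vertex does not have. A color class of size \<open>a\<close> becomes one of size
  \<open>a + k (n - a)\<close>, so the differences between class sizes are multiplied by \<open>-(k - 1)\<close>: they
  stay at most 1 if \<open>k = 2\<close>, and they are 0 throughout if \<open>3\<close> divides \<open>n\<close>. Fewer than three colors do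
  not suffice because a vertex and an edge of its cycle form a triangle.
\<close>

section \<open>Colorings as functions\<close>

text \<open>Disjointness makes the class of a vertex unique, so the family of classes can be traded
  for a color function. This form lets new colors be computed from old ones by arithmetic modulo 3.
  Classes may be empty on both sides.\<close>

lemma equitably_colorable_iff_coloring:
  "equitably_colorable G k \<longleftrightarrow> (\<exists>c. (\<forall>v\<in>pverts G. c v < k) \<and>
     (\<forall>u\<in>pverts G. \<forall>v\<in>pverts G. (u, v) \<in> parcs G \<longrightarrow> c u \<noteq> c v) \<and>
     (\<forall>i<k. \<forall>j<k. \<bar>int (card {v\<in>pverts G. c v = i}) - int (card {v\<in>pverts G. c v = j})\<bar> \<le> 1))"
    (is "_ \<longleftrightarrow> ?R")
proof
  assume "equitably_colorable G k"
  then obtain V :: "nat \<Rightarrow> 'a set" where V: "(\<Union>i<k. V i) = pverts G" "disjoint_family_on V {..<k}"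
     "\<forall>i<k. independent_set G (V i)"
     "\<forall>i<k. \<forall>j<k. \<bar>int (card (V i)) - int (card (V j))\<bar> \<le> 1"
    unfolding equitably_colorable_def by blast
  have "\<forall>v\<in>pverts G. \<exists>i<k. v \<in> V i" using V(1) by blast
  then obtain c where c: "\<And>v. v \<in> pverts G \<Longrightarrow> c v < k \<and> v \<in> V (c v)" by metis
  have c_eq: "c v = i" if "v \<in> V i" "i < k" for v i
  proof -
    have "v \<in> pverts G" using that V(1) by blast
    with c that V(2) show ?thesis unfolding disjoint_family_on_def by blast
  qed
  have "{v\<in>pverts G. c v = i} = V i" if "i < k" for i
    using c c_eq that V(1) by blast
  moreover have "c u \<noteq> c v" if "u \<in> pverts G" "v \<in> pverts G" "(u, v) \<in> parcs G" for u v
    using that c V(3) unfolding independent_set_def by metis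
  ultimately show ?R using c V(4) by (intro exI[of _ c]) auto
next
  assume ?R
  then obtain c where c: "\<forall>v\<in>pverts G. c v < k"
     "\<forall>u\<in>pverts G. \<forall>v\<in>pverts G. (u, v) \<in> parcs G \<longrightarrow> c u \<noteq> c v"
     "\<forall>i<k. \<forall>j<k. \<bar>int (card {v\<in>pverts G. c v = i}) - int (card {v\<in>pverts G. c v = j})\<bar> \<le> 1"
    by blast
  then show "equitably_colorable G k"
    unfolding equitably_colorable_def
    by (intro exI[of _ "\<lambda>i. {v\<in>pverts G. c v = i}"])
      (auto simp: disjoint_family_on_def independent_set_def, metis)
qed

lemma equitably_colorable_rename_verts:
  assumes "inj f" "equitably_colorable G k"
  shows "equitably_colorable (rename_verts f G) k"
proof -
  obtain c where c: "\<forall>v\<in>pverts G. c v < k"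
     "\<forall>u\<in>pverts G. \<forall>v\<in>pverts G. (u, v) \<in> parcs G \<longrightarrow> c u \<noteq> c v"
     "\<forall>i<k. \<forall>j<k. \<bar>int (card {v\<in>pverts G. c v = i}) - int (card {v\<in>pverts G. c v = j})\<bar> \<le> 1"
    using assms(2) unfolding equitably_colorable_iff_coloring by blast
  \<comment> \<open>Since \<open>inf f\<close> would be ambiguous without injectivity,
    \<open>inj f\<close> is what makes \<open>inv f\<close> recover the original vertex; each class
    is then the image of an old one.\<close>
  have "{v \<in> pverts (rename_verts f G). (c \<circ> inv f) v = i} = f ` {v \<in> pverts G. c v = i}" for i
    using assms(1) by (auto simp: rename_verts_def)
  then have "card {v \<in> pverts (rename_verts f G). (c \<circ> inv f) v = i}
      = card {v \<in> pverts G. c v = i}" for i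
    using assms(1) by (simp add: card_image inj_on_subset)
  with c show ?thesis
    unfolding equitably_colorable_iff_coloring
    using assms(1) by (intro exI[of _ "c \<circ> inv f"]) (auto simp: rename_verts_def inj_eq)
qed

section \<open>One corona step\<close>

text \<open>The even cycle matters only through its balanced bipartition, given here by
  \<open>d\<close>: each copy of \<open>H\<close> contributes \<open>k\<close> vertices to each of
  the two colors that its attachment vertex lacks.\<close>

lemma equitably_3_colorable_corona:
  fixes G :: "'a pair_pre_digraph" and H :: "'b pair_pre_digraph" and d :: "'b \<Rightarrow> bool"
  assumes "finite (pverts G)" "finite (pverts H)" "equitably_colorable G 3"
    and proper: "\<And>x y. (x, y) \<in> parcs H \<Longrightarrow> d x \<noteq> d y"
    and halves: "card {x\<in>pverts H. d x} = k" "card {x\<in>pverts H. \<not> d x} = k"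
    and "3 dvd card (pverts G) \<or> k = 2"
  shows "equitably_colorable (corona G H) 3"
proof -
  obtain c :: "'a \<Rightarrow> nat" where c: "\<forall>v\<in>pverts G. c v < 3"
     "\<forall>u\<in>pverts G. \<forall>v\<in>pverts G. (u, v) \<in> parcs G \<longrightarrow> c u \<noteq> c v"
     "\<forall>i<3. \<forall>j<3. \<bar>int (card {v\<in>pverts G. c v = i}) - int (card {v\<in>pverts G. c v = j})\<bar> \<le> 1"
    using assms(3) unfolding equitably_colorable_iff_coloring by blast
  define S where "S i = {v\<in>pverts G. c v = i}" for i
  \<comment> \<open>The shifts by 1 and by 2 modulo 3 produce the two colors different from
    \<open>c v\<close>, one for each side of the bipartition.\<close>
  define c' where "c' w = (case w of Inl v \<Rightarrow> c v
    | Inr (v, x) \<Rightarrow> if d x then (c v + 1) mod 3 else (c v + 2) mod 3)" for w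
  have less3: "(i < 3) = (i = 0 \<or> i = 1 \<or> i = 2)" for i :: nat by auto
  have finS: "finite (S i)" for i using assms(1) by (simp add: S_def)
  have "pverts G = S 0 \<union> S 1 \<union> S 2" using c(1) by (force simp: S_def)
  moreover have "card (S 0 \<union> S 1 \<union> S 2) = card (S 0) + card (S 1) + card (S 2)"
  proof -
    have "S 0 \<inter> S 1 = {}" "(S 0 \<union> S 1) \<inter> S 2 = {}" by (auto simp: S_def)
    then show ?thesis by (simp add: card_Un_disjoint finS)
  qed
  ultimately have card_G: "card (pverts G) = card (S 0) + card (S 1) + card (S 2)" by simp
  \<comment> \<open>The shifts by 1 and by 2 are inverse to each other modulo 3. Hence color
    \<open>i\<close> on the side \<open>d\<close> comes from vertices of color \<open>i + 2\<close>,
    and on the other side from vertices of color \<open>i + 1\<close>.\<close>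
  have class_eq: "{w \<in> pverts (corona G H). c' w = i} = Inl ` S i
      \<union> Inr ` (S ((i + 2) mod 3) \<times> {x\<in>pverts H. d x})
      \<union> Inr ` (S ((i + 1) mod 3) \<times> {x\<in>pverts H. \<not> d x})" if "i < 3" for i
  proof -
    have shift: "(c v + 1) mod 3 = i \<longleftrightarrow> c v = (i + 2) mod 3"
      "(c v + 2) mod 3 = i \<longleftrightarrow> c v = (i + 1) mod 3" if "v \<in> pverts G" for v
    proof -
      have "c v < 3" using c(1) that by blast
      with \<open>i < 3\<close> show "(c v + 1) mod 3 = i \<longleftrightarrow> c v = (i + 2) mod 3"
        "(c v + 2) mod 3 = i \<longleftrightarrow> c v = (i + 1) mod 3"
        unfolding less3 by (elim disjE; simp)+
    qed
    show ?thesis (is "?L = ?R")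
    proof (rule set_eqI)
      fix w
      show "w \<in> ?L \<longleftrightarrow> w \<in> ?R"
      proof (cases w)
        case (Inl v)
        then show ?thesis by (auto simp: corona_def c'_def S_def)
      next
        case (Inr p)
        obtain v x where p: "p = (v, x)" by fastforce
        have "w \<in> ?L \<longleftrightarrow> v \<in> pverts G \<and> x \<in> pverts H \<and>
            (if d x then (c v + 1) mod 3 = i else (c v + 2) mod 3 = i)"
          using Inr p by (auto simp: corona_def c'_def)
        also have "\<dots> \<longleftrightarrow> v \<in> pverts G \<and> x \<in> pverts H \<and>
            (if d x then c v = (i + 2) mod 3 else c v = (i + 1) mod 3)"
          using shift by meson
        also have "\<dots> \<longleftrightarrow> w \<in> ?R"
          using Inr p by (auto simp: S_def)
        finally show ?thesis .
      qed
    qed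
  qed
  have class_card: "card {w \<in> pverts (corona G H). c' w = i}
      = card (S i) + k * card (S ((i + 2) mod 3)) + k * card (S ((i + 1) mod 3))" if "i < 3" for i
  proof -
    let ?A = "Inl ` S i :: ('a + 'a \<times> 'b) set"
      and ?B = "Inr ` (S ((i + 2) mod 3) \<times> {x\<in>pverts H. d x}) :: ('a + 'a \<times> 'b) set"
      and ?C = "Inr ` (S ((i + 1) mod 3) \<times> {x\<in>pverts H. \<not> d x}) :: ('a + 'a \<times> 'b) set"
    have "?A \<inter> ?B = {}" "(?A \<union> ?B) \<inter> ?C = {}" by blast+
    moreover have "finite ?A" "finite ?B" "finite ?C" using finS assms(2) by simp_all
    ultimately have "card (?A \<union> ?B \<union> ?C) = card ?A + card ?B + card ?C"
      by (simp only: card_Un_disjoint finite_Un)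
    then show ?thesis
      unfolding class_eq[OF that] by (simp add: card_image card_cartesian_product halves mult.commute)
  qed
  have sizes: "card {w \<in> pverts (corona G H). c' w = 0} = card (S 0) + k * card (S 2) + k * card (S 1)"
    "card {w \<in> pverts (corona G H). c' w = 1} = card (S 1) + k * card (S 0) + k * card (S 2)"
    "card {w \<in> pverts (corona G H). c' w = 2} = card (S 2) + k * card (S 1) + k * card (S 0)"
    using class_card[of 0] class_card[of 1] class_card[of 2]
    by (simp_all add: numeral_2_eq_2)
  have diffs: "\<bar>int (card (S i)) - int (card (S j))\<bar> \<le> 1" if "i < 3" "j < 3" for i j
    using c(3) that by (auto simp: S_def)
  have "\<bar>int (card {w \<in> pverts (corona G H). c' w = i})
      - int (card {w \<in> pverts (corona G H). c' w = j})\<bar> \<le> 1" if "i < 3" "j < 3" for i j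
    using assms(7)
  proof
    assume "3 dvd card (pverts G)"
    \<comment> \<open>If the sum is \<open>3 * q\<close> and one number exceeded \<open>q\<close>,
      the others would be at least \<open>q\<close> and the sum too large; symmetrically from below.
      With three equal classes of size \<open>s\<close>, every new class has size
      \<open>s + 2 * k * s\<close>.\<close>
    moreover have "a = b \<and> b = e" if dvd: "3 dvd a + b + e"
      and diff: "\<bar>int a - int b\<bar> \<le> 1" "\<bar>int a - int e\<bar> \<le> 1" "\<bar>int b - int e\<bar> \<le> 1" for a b e :: nat
    proof -
      obtain q where "a + b + e = 3 * q" using dvd by (rule dvdE)
      with diff have "a = q" "b = q" "e = q" unfolding abs_le_iff by linarith+
      then show ?thesis by simp
    qed
    ultimately have "card (S 0) = card (S 1)" "card (S 1) = card (S 2)"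
      using card_G diffs[of 0 1] diffs[of 0 2] diffs[of 1 2] by simp_all
    with sizes that show ?thesis unfolding less3 by auto
  next
    \<comment> \<open>If \<open>N\<close> is the number of vertices of \<open>G\<close>, a class of
      size \<open>s\<close> becomes one of size \<open>s + 2 * (N - s) = 2 * N - s\<close>, so
      differences only change sign.\<close>
    assume "k = 2"
    with sizes that diffs[of 0 1] diffs[of 0 2] diffs[of 1 2] show ?thesis
      unfolding less3 by auto
  qed
  moreover have "c' w < 3" if "w \<in> pverts (corona G H)" for w
    using that c(1) by (auto simp: corona_def c'_def)
  moreover have "c' w \<noteq> c' z" if "w \<in> pverts (corona G H)" "z \<in> pverts (corona G H)"
    "(w, z) \<in> parcs (corona G H)" for w z
  proof -
    \<comment> \<open>The first two inequalities settle the arcs between a vertex and its copy of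
      \<open>H\<close>; the third, together with \<open>proper\<close>, settles the arcs inside a
      copy.\<close>
    have neq: "(m + 1) mod 3 \<noteq> m" "(m + 2) mod 3 \<noteq> m" "(m + 1) mod 3 \<noteq> (m + 2) mod 3"
      if "m < 3" for m :: nat
      using that unfolding less3 by (elim disjE; simp)+
    show ?thesis
    proof (cases w; cases z)
      fix u v assume "w = Inl u" "z = Inl v"
      with that c(2) show ?thesis by (auto simp: c'_def corona_def)
    next
      fix u b assume wz: "w = Inl u" "z = Inr b"
      obtain v y where "b = (v, y)" by fastforce
      with that wz c(1) have "c u < 3" "c' w = c u" "c' z = (if d y then (c u + 1) mod 3 else (c u + 2) mod 3)"
        by (auto simp: c'_def)
      with neq[of "c u"] show ?thesis by metis
    next
      fix a v assume wz: "w = Inr a" "z = Inl v"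
      obtain u x where "a = (u, x)" by fastforce
      with that wz c(1) have "c v < 3" "c' z = c v" "c' w = (if d x then (c v + 1) mod 3 else (c v + 2) mod 3)"
        by (auto simp: c'_def)
      with neq[of "c v"] show ?thesis by metis
    next
      fix a b assume wz: "w = Inr a" "z = Inr b"
      obtain u x v y where "a = (u, x)" "b = (v, y)" by fastforce
      with that wz c(1) have "c v < 3" "(x, y) \<in> parcs H"
        "c' w = (if d x then (c v + 1) mod 3 else (c v + 2) mod 3)"
        "c' z = (if d y then (c v + 1) mod 3 else (c v + 2) mod 3)"
        by (auto simp: c'_def)
      with neq[of "c v"] proper[of x y] show ?thesis by metis
    qed
  qed
  ultimately show ?thesis
    unfolding equitably_colorable_iff_coloring by (intro exI[of _ c']) blast
qed

section \<open>Parity on even cycles\<close>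

text \<open>Reduction modulo the even number \<open>2 * k\<close> preserves parity, so the successor
  changes parity also where the cycle closes up.\<close>

lemma cycle_graph_even_proper:
  assumes "(x, y) \<in> parcs (cycle_graph (2 * k))"
  shows "even x \<noteq> even y"
proof -
  have "even (Suc z mod (2 * k)) = even (Suc z)" for z
    by (simp add: dvd_mod_iff)
  with assms show ?thesis by (auto simp: cycle_graph_def)
qed

lemma card_even_odd_less_double:
  "card {x::nat. x < 2 * k \<and> even x} = k" "card {x::nat. x < 2 * k \<and> odd x} = k"
proof -
  have "{x::nat. x < 2 * k \<and> even x} = (\<lambda>i. 2 * i) ` {..<k}" by (auto elim!: evenE)
  then show "card {x::nat. x < 2 * k \<and> even x} = k" by (simp add: card_image inj_on_def)
  have "{x::nat. x < 2 * k \<and> odd x} = (\<lambda>i. 2 * i + 1) ` {..<k}" by (auto elim!: oddE)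
  then show "card {x::nat. x < 2 * k \<and> odd x} = k" by (simp add: card_image inj_on_def)
qed

section \<open>Iterating the corona\<close>

lemma card_pverts_corona:
  fixes G :: "'a pair_pre_digraph" and H :: "'b pair_pre_digraph"
  assumes "finite (pverts G)" "finite (pverts H)"
  shows "card (pverts (corona G H)) = card (pverts G) * (card (pverts H) + 1)"
proof -
  let ?A = "Inl ` pverts G :: ('a + 'a \<times> 'b) set"
    and ?B = "Inr ` (pverts G \<times> pverts H) :: ('a + 'a \<times> 'b) set"
  have "card (?A \<union> ?B) = card ?A + card ?B"
    using assms by (intro card_Un_disjoint) auto
  then have "card (pverts (corona G H)) = card ?A + card ?B"
    by (simp add: corona_def)
  then show ?thesis by (simp add: card_image card_cartesian_product)
qed

lemma card_pverts_rename_verts: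
  assumes "inj f"
  shows "card (pverts (rename_verts f G)) = card (pverts G)"
  using assms by (simp add: rename_verts_def card_image inj_on_subset)

text \<open>Each corona multiplies the number of vertices by \<open>card (pverts H) + 1\<close>.
  Thus divisibility by 3 passes from \<open>G\<close> to every iterate, where the corona step asks
  for it again.\<close>

lemma dvd_card_pverts_iterated_corona:
  assumes "pair_graph G" "pair_graph H"
  shows "card (pverts G) dvd card (pverts (iterated_corona l G H))"
proof (induction l)
  case 0
  then show ?case by (simp add: card_pverts_rename_verts inj_def)
next
  case (Suc l)
  interpret I: pair_graph "iterated_corona l G H" by (intro pair_graph_iterated_corona assms)
  interpret H: pair_graph H by fact
  have "card (pverts (iterated_corona (Suc l) G H))
      = card (pverts (iterated_corona l G H)) * (card (pverts H) + 1)"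
    by (simp add: card_pverts_rename_verts card_pverts_corona inj_def)
  with Suc show ?case by (metis dvd_mult2)
qed

lemma equitably_3_colorable_iterated_corona_cycle:
  assumes "pair_graph G" "equitably_colorable G 3" "k \<ge> 2"
    and "3 dvd card (pverts G) \<or> k = 2"
  shows "equitably_colorable (iterated_corona l G (cycle_graph (2 * k))) 3"
proof (induction l)
  case 0
  then show ?case using assms(2) by (simp add: equitably_colorable_rename_verts inj_def)
next
  case (Suc l)
  let ?C = "cycle_graph (2 * k)"
  have C: "pair_graph ?C" using assms(3) by (intro pair_graph_cycle_graph) simp
  interpret I: pair_graph "iterated_corona l G ?C"
    by (intro pair_graph_iterated_corona assms(1) C)
  interpret C: pair_graph ?C by fact
  have "equitably_colorable (corona (iterated_corona l G ?C) ?C) 3"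
  \<comment> \<open>Parity of the cycle vertices takes the role of \<open>d\<close>.\<close>
  proof (rule equitably_3_colorable_corona)
    show "card {x \<in> pverts ?C. even x} = k" "card {x \<in> pverts ?C. odd x} = k"
      by (simp_all add: cycle_graph_def card_even_odd_less_double)
    show "3 dvd card (pverts (iterated_corona l G ?C)) \<or> k = 2"
      using assms(4) dvd_card_pverts_iterated_corona[OF assms(1) C] dvd_trans by blast
  qed (use Suc cycle_graph_even_proper in auto)
  then show ?case by (simp add: equitably_colorable_rename_verts inj_def)
qed

section \<open>Lower bound\<close>

lemma equitably_colorable_triangle_ge_3:
  assumes "{u, v, w} \<subseteq> pverts G" "(u, v) \<in> parcs G" "(v, w) \<in> parcs G" "(u, w) \<in> parcs G"
    and "equitably_colorable G m"
  shows "m \<ge> 3"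
proof -
  obtain c where "\<forall>v\<in>pverts G. c v < m"
     "\<forall>u\<in>pverts G. \<forall>v\<in>pverts G. (u, v) \<in> parcs G \<longrightarrow> c u \<noteq> c v"
    using assms(5) unfolding equitably_colorable_iff_coloring by blast
  with assms(1-4) have "c u < m" "c v < m" "c w < m" "c u \<noteq> c v" "c v \<noteq> c w" "c u \<noteq> c w"
    by auto
  then show ?thesis by linarith
qed

text \<open>The vertex \<open>a\<close> and the arc from \<open>x\<close> to \<open>y\<close> in its
  copy of \<open>H\<close> span a triangle, and \<open>f\<close> carries arcs to arcs.\<close>

lemma equitably_colorable_corona_ge_3:
  assumes "a \<in> pverts G" "x \<in> pverts H" "y \<in> pverts H" "(x, y) \<in> parcs H"
    and "equitably_colorable (rename_verts f (corona G H)) m"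
  shows "m \<ge> 3"
proof (rule equitably_colorable_triangle_ge_3[OF _ _ _ _ assms(5)])
  let ?u = "Inl a" and ?v = "Inr (a, x)" and ?w = "Inr (a, y)"
  show "{f ?u, f ?v, f ?w} \<subseteq> pverts (rename_verts f (corona G H))"
    using assms by (auto simp: rename_verts_def corona_def)
  have "(f p, f q) \<in> parcs (rename_verts f (corona G H))" if "(p, q) \<in> parcs (corona G H)" for p q
    using that by (force simp: rename_verts_def)
  then show "(f ?u, f ?v) \<in> parcs (rename_verts f (corona G H))"
    "(f ?v, f ?w) \<in> parcs (rename_verts f (corona G H))"
    "(f ?u, f ?w) \<in> parcs (rename_verts f (corona G H))"
    using assms by auto
qed

theorem theorem2:
  fixes G :: "'a pair_pre_digraph" and n k l :: nat
  assumes "pair_graph G" and "connected (with_proj G)"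
    and "card (pverts G) = n" and "n \<ge> 2"
    and "equitably_colorable G 3"
    and "k \<ge> 2" and "l \<ge> 1"
    and "3 dvd n \<or> k = 2"
  shows "equitable_chromatic_number (iterated_corona l G (cycle_graph (2 * k))) = 3"
  unfolding equitable_chromatic_number_def
proof (rule Least_equality)
  let ?C = "cycle_graph (2 * k)"
  show "equitably_colorable (iterated_corona l G ?C) 3"
    using assms by (intro equitably_3_colorable_iterated_corona_cycle) auto
  fix m assume m: "equitably_colorable (iterated_corona l G ?C) m"
  \<comment> \<open>As \<open>l\<close> is positive, the graph is a renamed corona of the iterate
    \<open>l'\<close>. That iterate is nonempty because \<open>G\<close> is, so its outermost cycles
    supply a triangle.\<close>
  obtain l' where l: "l = Suc l'" using assms(7) by (cases l) auto
  have "pverts G \<noteq> {}" using assms(3,4) by auto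
  then have "pverts (iterated_corona l' G ?C) \<noteq> {}"
    by (induction l') (auto simp: rename_verts_def corona_def)
  then obtain a where "a \<in> pverts (iterated_corona l' G ?C)" by blast
  moreover have "0 \<in> pverts ?C" "1 \<in> pverts ?C" "(0, 1) \<in> parcs ?C"
    using assms(6) by (auto simp: cycle_graph_def)
  ultimately show "3 \<le> m"
    using m[unfolded l iterated_corona.simps] by (rule equitably_colorable_corona_ge_3)
qed

end
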